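(* Let $\mathbb{H}$ be a complex Hilbert space and let $S,T\in\mathbb{B}(\mathbb{H})$. Then \[\|S+T\|\le 2\int_0^1 \omega\left(\begin{bmatrix} O & (1-t)S+tT\\ tS^*+(1-t)T^* & O\end{bmatrix}\right)dt\le 2\,\omega\left(\begin{bmatrix} O & S\\ T^* & O\end{bmatrix}\right).\]
   Context: $\mathbb{B}(\mathbb{H})$ denotes the $C^*$-algebra of all bounded linear operators on $\mathbb{H}$, $\|\cdot\|$ is the operator norm, $X^*$ is the adjoint of $X$, and $O$ is the zero operator. The numerical radius of an operator $X$ on a complex Hilbert space is $\omega(X)=\sup_{\|x\|=1}|\langle Xx,x\rangle|$. A $2\times 2$ block matrix with entries in $\mathbb{B}(\mathbb{H})$ is regarded as an operator on the Hilbert space direct sum $\mathbb{H}\oplus\mathbb{H}$. *)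

theory Defs
  imports "HOL-Analysis.Analysis"
begin

class scaleC =
  fixes scaleC :: "complex \<Rightarrow> 'a \<Rightarrow> 'a"  (infixr "*\<^sub>C" 75)

text \<open>The inner product is linear in the first argument. Positive definiteness is not a
  separate axiom: it follows from \<open>cinner_self\<close> and the corresponding property of the norm.\<close>

class complex_inner = scaleC + real_normed_vector +
  fixes cinner :: "'a \<Rightarrow> 'a \<Rightarrow> complex"
  assumes scaleC_add_right: "c *\<^sub>C (x + y) = c *\<^sub>C x + c *\<^sub>C y"
    and scaleC_add_left: "(c + d) *\<^sub>C x = c *\<^sub>C x + d *\<^sub>C x"
    and scaleC_scaleC: "c *\<^sub>C d *\<^sub>C x = (c * d) *\<^sub>C x"
    and scaleC_one: "1 *\<^sub>C x = x"
    and scaleR_scaleC: "r *\<^sub>R x = complex_of_real r *\<^sub>C x"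
    and cinner_commute: "cinner x y = cnj (cinner y x)"
    and cinner_add_left: "cinner (x + y) z = cinner x z + cinner y z"
    and cinner_scaleC_left: "cinner (c *\<^sub>C x) y = c * cinner x y"
    and cinner_self: "cinner x x = complex_of_real ((norm x)\<^sup>2)"

class chilbert_space = complex_inner + complete_space

instantiation complex :: chilbert_space
begin

definition scaleC_complex_def: "c *\<^sub>C (x :: complex) = c * x"

definition cinner_complex_def: "cinner (x :: complex) y = x * cnj y"

instance
proof
  fix x y z c d :: complex and r :: real
  show "c *\<^sub>C (x + y) = c *\<^sub>C x + c *\<^sub>C y"
    by (simp add: scaleC_complex_def distrib_left)
  show "(c + d) *\<^sub>C x = c *\<^sub>C x + d *\<^sub>C x"
    by (simp add: scaleC_complex_def distrib_right)
  show "c *\<^sub>C d *\<^sub>C x = (c * d) *\<^sub>C x"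
    by (simp add: scaleC_complex_def mult.assoc)
  show "1 *\<^sub>C x = x"
    by (simp add: scaleC_complex_def)
  show "r *\<^sub>R x = complex_of_real r *\<^sub>C x"
    by (simp add: scaleC_complex_def scaleR_conv_of_real)
  show "cinner x y = cnj (cinner y x)"
    by (simp add: cinner_complex_def mult.commute)
  show "cinner (x + y) z = cinner x z + cinner y z"
    by (simp add: cinner_complex_def distrib_right)
  show "cinner (c *\<^sub>C x) y = c * cinner x y"
    by (simp add: cinner_complex_def scaleC_complex_def mult.assoc)
  show "cinner x x = complex_of_real ((norm x)\<^sup>2)"
    unfolding cinner_complex_def by (rule complex_norm_square[symmetric])
qed

end

text \<open>The Hilbert space direct sum, carried by the product type; its norm is the
  \<open>\<ell>\<^sup>2\<close> norm that the library already puts on products.\<close>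

instantiation prod :: (complex_inner, complex_inner) complex_inner
begin

definition scaleC_prod_def: "c *\<^sub>C p = (c *\<^sub>C fst p, c *\<^sub>C snd p)"

definition cinner_prod_def: "cinner p q = cinner (fst p) (fst q) + cinner (snd p) (snd q)"

instance
proof
  fix p q r :: "'a \<times> 'b" and c d :: complex and a :: real
  show "c *\<^sub>C (p + q) = c *\<^sub>C p + c *\<^sub>C q"
    by (simp add: scaleC_prod_def scaleC_add_right)
  show "(c + d) *\<^sub>C p = c *\<^sub>C p + d *\<^sub>C p"
    by (simp add: scaleC_prod_def scaleC_add_left)
  show "c *\<^sub>C d *\<^sub>C p = (c * d) *\<^sub>C p"
    by (simp add: scaleC_prod_def scaleC_scaleC)
  show "1 *\<^sub>C p = p"
    by (simp add: scaleC_prod_def scaleC_one)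
  show "a *\<^sub>R p = complex_of_real a *\<^sub>C p"
    by (simp add: scaleC_prod_def scaleR_scaleC scaleR_prod_def)
  show "cinner p q = cnj (cinner q p)"
    by (simp add: cinner_prod_def cinner_commute[symmetric])
  show "cinner (p + q) r = cinner p r + cinner q r"
    by (simp add: cinner_prod_def cinner_add_left)
  show "cinner (c *\<^sub>C p) q = c * cinner p q"
    by (simp add: cinner_prod_def scaleC_prod_def cinner_scaleC_left algebra_simps)
  show "cinner p p = complex_of_real ((norm p)\<^sup>2)"
    by (simp add: cinner_prod_def cinner_self norm_prod_def)
qed

end

instance prod :: (chilbert_space, chilbert_space) chilbert_space ..

text \<open>The library type of bounded operators only provides real linearity; the elements of
  \<open>B(H)\<close> are those that are complex linear. On them the library norm is the usual
  operator norm.\<close>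

definition bounded_ops :: "('a::complex_inner \<Rightarrow>\<^sub>L 'a) set" where
  "bounded_ops = {X. \<forall>c x. blinfun_apply X (c *\<^sub>C x) = c *\<^sub>C blinfun_apply X x}"

text \<open>For complex linear \<open>X\<close> exactly one such \<open>Y\<close> exists, by the Riesz representation theorem;
  it is again complex linear.\<close>

definition adjoint_op :: "('a::chilbert_space \<Rightarrow>\<^sub>L 'a) \<Rightarrow> ('a \<Rightarrow>\<^sub>L 'a)" where
  "adjoint_op X =
     (THE Y. \<forall>x y. cinner (blinfun_apply X x) y = cinner x (blinfun_apply Y y))"

text \<open>The value 0 is adjoined so that the numerical radius on the zero space, where there are no
  unit vectors, is 0; otherwise it does not affect the supremum.\<close>

definition numerical_radius :: "('a::complex_inner \<Rightarrow>\<^sub>L 'a) \<Rightarrow> real" where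
  "numerical_radius X =
     Sup (insert 0 {cmod (cinner (blinfun_apply X x) x) | x. norm x = 1})"

text \<open>\<open>block_op A B C D\<close> has first row \<open>A B\<close> and second row \<open>C D\<close>.\<close>

lift_definition block_op ::
  "('a::complex_inner \<Rightarrow>\<^sub>L 'a) \<Rightarrow> ('a \<Rightarrow>\<^sub>L 'a) \<Rightarrow> ('a \<Rightarrow>\<^sub>L 'a) \<Rightarrow> ('a \<Rightarrow>\<^sub>L 'a)
    \<Rightarrow> ('a \<times> 'a) \<Rightarrow>\<^sub>L ('a \<times> 'a)"
  is "\<lambda>A B C D (p :: 'a \<times> 'a). (A (fst p) + B (snd p), C (fst p) + D (snd p))"
  by (intro bounded_linear_Pair bounded_linear_add
      bounded_linear_compose[OF _ bounded_linear_fst]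
      bounded_linear_compose[OF _ bounded_linear_snd])

end

(* The block operator at parameter t is (1 - t) M + t M*, where M has off-diagonal entries S and T*.
   As the numerical radius is a seminorm invariant under taking adjoints, it is at most \<omega>(M) there.
   Below, it is at least ||S + T|| / 2 for every single t: the real part of the quadratic form at
   (u, v) is Re <(S + T) v, u>, and one takes u in the direction of (S + T) v with norm that of v. *)
theory Submission
  imports Defs
begin

section \<open>Complex inner product spaces\<close>

lemma cinner_add_right: "cinner x (y + z) = cinner x y + cinner x z"
  for x y z :: "'a::complex_inner"
  by (metis cinner_add_left cinner_commute complex_cnj_add)

lemma cinner_scaleC_right: "cinner x (c *\<^sub>C y) = cnj c * cinner x y"
  for x y :: "'a::complex_inner"
  by (metis cinner_commute cinner_scaleC_left complex_cnj_mult)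

lemma cinner_scaleR_left: "cinner (r *\<^sub>R x) y = of_real r * cinner x y"
  for x y :: "'a::complex_inner"
  by (simp add: scaleR_scaleC cinner_scaleC_left)

lemma cinner_scaleR_right: "cinner x (r *\<^sub>R y) = of_real r * cinner x y"
  for x y :: "'a::complex_inner"
  by (simp add: scaleR_scaleC cinner_scaleC_right)

lemma cinner_diff_left: "cinner (x - y) z = cinner x z - cinner y z"
  for x y z :: "'a::complex_inner"
  by (metis add_diff_cancel_right' cinner_add_left diff_add_cancel)

lemma cinner_diff_right: "cinner x (y - z) = cinner x y - cinner x z"
  for x y z :: "'a::complex_inner"
  by (metis add_diff_cancel_right' cinner_add_right diff_add_cancel)

lemma cinner_zero_left [simp]: "cinner 0 y = 0"
  for y :: "'a::complex_inner"
  using cinner_diff_left[of y y y] by simp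

lemma power2_norm_add:
  "(norm (x + y))\<^sup>2 = (norm x)\<^sup>2 + 2 * Re (cinner x y) + (norm y)\<^sup>2"
  for x y :: "'a::complex_inner"
proof -
  have "complex_of_real ((norm (x + y))\<^sup>2) = cinner x x + cinner x y + cinner y x + cinner y y"
    by (simp only: cinner_self[symmetric] cinner_add_left cinner_add_right ac_simps)
  then have "(norm (x + y))\<^sup>2 = Re (cinner x x + cinner x y + cinner y x + cinner y y)"
    by (metis Re_complex_of_real)
  moreover have "Re (cinner y x) = Re (cinner x y)"
    by (subst cinner_commute) simp
  ultimately show ?thesis
    by (simp add: cinner_self)
qed

text \<open>The norm is assumed homogeneous for real scalars only. For complex ones, homogeneity
  comes out of \<open>cinner_self\<close>, since the scalar leaves the two arguments as c and its
  conjugate.\<close>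

lemma norm_scaleC: "norm (c *\<^sub>C x) = cmod c * norm x"
  for x :: "'a::complex_inner"
proof -
  have "complex_of_real ((norm (c *\<^sub>C x))\<^sup>2) = of_real ((cmod c * norm x)\<^sup>2)"
    using complex_norm_square[of c]
    by (simp only: cinner_self[symmetric] cinner_scaleC_left cinner_scaleC_right)
      (simp add: cinner_self power_mult_distrib)
  then have "(norm (c *\<^sub>C x))\<^sup>2 = (cmod c * norm x)\<^sup>2"
    using of_real_eq_iff by blast
  then show ?thesis
    by (simp add: power2_eq_iff_nonneg)
qed

text \<open>The triangle inequality is already an axiom of the norm, so Cauchy-Schwarz is deduced
  from it: after squaring, only the cross terms remain.\<close>

lemma Re_cinner_le: "Re (cinner x y) \<le> norm x * norm y"
  for x y :: "'a::complex_inner"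
proof -
  have "(norm (x + y))\<^sup>2 \<le> (norm x + norm y)\<^sup>2"
    by (simp add: norm_triangle_ineq power_mono)
  then show ?thesis
    by (simp add: power2_norm_add power2_sum)
qed

lemma cmod_cinner_le: "cmod (cinner x y) \<le> norm x * norm y"
  for x y :: "'a::complex_inner"
proof (cases "cinner x y = 0")
  case False
  \<comment> \<open>The phase that rotates \<open>cinner x y\<close> onto its modulus, so that the
    bound on real parts can be applied to \<open>c *\<^sub>C x\<close>.\<close>
  define c where "c = cnj (sgn (cinner x y))"
  have "cmod c = 1"
    using False by (simp add: c_def norm_sgn)
  moreover have "c * cinner x y = of_real (cmod (cinner x y))"
    using False complex_norm_square[of "cinner x y"]
    by (simp add: c_def sgn_div_norm scaleR_conv_of_real divide_simps power2_eq_square mult.commute)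
  ultimately show ?thesis
    using Re_cinner_le[of "c *\<^sub>C x" y] by (simp add: norm_scaleC cinner_scaleC_left)
qed simp

lemma cinner_left_eqI: "y = z" if "\<And>x. cinner x y = cinner x z"
  for y z :: "'a::complex_inner"
proof -
  have "cinner (y - z) (y - z) = 0"
    using that by (simp add: cinner_diff_right)
  then show ?thesis
    by (simp add: cinner_self)
qed

section \<open>Riesz representation and adjoints\<close>

text \<open>The representing vector minimises \<open>\<parallel>y\<parallel>\<^sup>2 - 2 f y\<close>; minimising sequences
  are Cauchy by the parallelogram law.\<close>

lemma riesz_representation_real:
  fixes f :: "'a::chilbert_space \<Rightarrow> real"
  assumes "bounded_linear f"
  obtains y where "\<And>w. f w = Re (cinner w y)"
proof -
  interpret f: bounded_linear f by fact
  obtain K where K: "\<And>x. \<bar>f x\<bar> \<le> norm x * K"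
    using f.bounded by auto
  define \<phi> where "\<phi> y = (norm y)\<^sup>2 - 2 * f y" for y
  define m where "m = Inf (range \<phi>)"
  \<comment> \<open>Completing the square: \<phi> y \<ge> (norm y)^2 - 2 K norm y = (norm y - K)^2 -
    K^2.\<close>
  have "- K\<^sup>2 \<le> \<phi> y" for y
    using K[of y] zero_le_power2[of "norm y - K"] by (simp add: \<phi>_def power2_diff)
  then have "bdd_below (range \<phi>)"
    by (rule bdd_belowI2)
  then have m_le: "m \<le> \<phi> y" for y
    unfolding m_def by (simp add: cInf_lower)
  have "\<exists>y. \<phi> y < m + inverse (Suc n)" for n
    using cInf_lessD[of "range \<phi>" "m + inverse (Suc n)"] by (auto simp: m_def)
  then obtain y where y: "\<And>n. \<phi> (y n) < m + inverse (Suc n)"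
    by metis
  \<comment> \<open>The linear terms of the three values of \<open>\<phi>\<close> cancel, which
    leaves the parallelogram law for the norm.\<close>
  have parallelogram: "(norm (u - v))\<^sup>2 = 2 * \<phi> u + 2 * \<phi> v - 4 * \<phi> ((1/2) *\<^sub>R (u + v))" for u v
  proof -
    have "(norm (u - v))\<^sup>2 = (norm u)\<^sup>2 - 2 * Re (cinner u v) + (norm v)\<^sup>2"
      using power2_norm_add[of u "(-1) *\<^sub>R v"] unfolding cinner_scaleR_right by simp
    then show ?thesis
      by (simp add: \<phi>_def f.add f.scaleR power2_norm_add[of u v] power_divide
          add_divide_distrib
          del: scaleR_add_right)
  qed
  have "Cauchy y"
  proof (rule metric_CauchyI)
    fix e :: real
    assume "0 < e"
    \<comment> \<open>Values at indices from N on are below m + 1/(N+1), and at midpoints \<phi> is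
      at least m. The parallelogram identity then bounds the squared distance by 4/(N+1), whence e^2
      / 4.\<close>
    then obtain N where N: "inverse (real (Suc N)) < e\<^sup>2 / 4"
      using reals_Archimedean[of "e\<^sup>2 / 4"] by auto
    have "dist (y i) (y j) < e" if "i \<ge> N" "j \<ge> N" for i j
    proof -
      have "inverse (real (Suc i)) \<le> inverse (real (Suc N))"
        "inverse (real (Suc j)) \<le> inverse (real (Suc N))"
        using that by (auto intro: le_imp_inverse_le)
      then have "(norm (y i - y j))\<^sup>2 < e\<^sup>2"
        using parallelogram[of "y i" "y j"] y[of i] y[of j] m_le[of "(1/2) *\<^sub>R (y i + y j)"] N
        by linarith
      then show ?thesis
        using \<open>0 < e\<close> by (simp add: dist_norm power2_less_imp_less)
    qed
    then show "\<exists>N. \<forall>i\<ge>N. \<forall>j\<ge>N. dist (y i) (y j) < e"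
      by blast
  qed
  then obtain l where l: "y \<longlonglongrightarrow> l"
    using Cauchy_convergent_iff convergent_def by blast
  have "(\<lambda>n. \<phi> (y n)) \<longlonglongrightarrow> \<phi> l"
    unfolding \<phi>_def by (intro tendsto_intros f.tendsto l)
  moreover have "(\<lambda>n. m + inverse (real (Suc n))) \<longlonglongrightarrow> m"
    using tendsto_add[OF tendsto_const LIMSEQ_inverse_real_of_nat, of m] by simp
  ultimately have "\<phi> l \<le> m"
    by (rule LIMSEQ_le) (use y in \<open>blast intro: less_imp_le\<close>)
  then have min: "\<phi> l \<le> \<phi> w" for w
    using m_le[of w] by linarith
  have "f w = Re (cinner w l)" for w
  proof (rule ccontr)
    assume ne: "f w \<noteq> Re (cinner w l)"
    define d where "d = f w - Re (cinner w l)"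
    \<comment> \<open>Moving from l to l + r w changes \<open>\<phi>\<close> by r^2 (norm w)^2 - 2 r
      d. With this r the change is -r^2 ((norm w)^2 + 2), which contradicts minimality when d is
      nonzero. The summand 1 keeps the denominator positive for w = 0 too.\<close>
    define r where "r = d / ((norm w)\<^sup>2 + 1)"
    have pos: "0 < (norm w)\<^sup>2 + 1"
      by (simp add: add_nonneg_pos)
    have "Re (cinner l w) = Re (cinner w l)"
      by (subst cinner_commute) simp
    then have "\<phi> (l + r *\<^sub>R w) = \<phi> l + r\<^sup>2 * (norm w)\<^sup>2 - 2 * r * d"
      by (simp add: \<phi>_def d_def power2_norm_add f.add f.scaleR cinner_scaleR_right
          power_mult_distrib algebra_simps)
    then have "2 * r * d \<le> r\<^sup>2 * (norm w)\<^sup>2"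
      using min[of "l + r *\<^sub>R w"] by linarith
    moreover have "d = r * ((norm w)\<^sup>2 + 1)"
      using pos by (simp add: r_def)
    ultimately have "r\<^sup>2 * ((norm w)\<^sup>2 + 2) \<le> 0"
      by (simp add: power2_eq_square algebra_simps)
    moreover have "r \<noteq> 0"
      using ne pos by (simp add: r_def d_def)
    ultimately show False
      by (smt (verit) mult_pos_pos zero_le_power2 zero_less_power2)
  qed
  then show thesis
    by (rule that)
qed

text \<open>\<open>adjoint_op\<close> is a definite description, so a bounded operator with the
  adjoint property has to be exhibited and shown unique. Riesz yields its value at each y;
  uniqueness is \<open>cinner_left_eqI\<close>.\<close>

lemma cinner_adjoint_op:
  fixes X :: "'a::chilbert_space \<Rightarrow>\<^sub>L 'a"
  assumes "X \<in> bounded_ops"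
  shows "cinner (X x) y = cinner x (adjoint_op X y)"
proof -
  have X_scaleC: "X (c *\<^sub>C x) = c *\<^sub>C X x" for c x
    using assms by (simp add: bounded_ops_def)
  have "\<exists>g. \<forall>x. cinner (X x) y = cinner x g" for y
  proof -
    have "bounded_linear (\<lambda>x. Re (cinner (X x) y))"
    proof (rule bounded_linear_intro)
      show "norm (Re (cinner (X x) y)) \<le> norm x * (norm X * norm y)" for x
      proof -
        have "norm (Re (cinner (X x) y)) \<le> norm (X x) * norm y"
          using abs_Re_le_cmod cmod_cinner_le by (metis order_trans real_norm_def)
        also have "\<dots> \<le> norm X * norm x * norm y"
          by (simp add: mult_right_mono norm_blinfun)
        finally show ?thesis
          by (simp add: ac_simps)
      qed
    qed (simp_all add: blinfun.add_right blinfun.scaleR_right cinner_add_left cinner_scaleR_left)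
    then obtain g where Re_eq: "\<And>x. Re (cinner (X x) y) = Re (cinner x g)"
      using riesz_representation_real by blast
    \<comment> \<open>Complex linearity of X recovers imaginary parts from real ones, as Re (i z) =
      - Im z.\<close>
    have "Im (cinner (X x) y) = Im (cinner x g)" for x
      using Re_eq[of "\<i> *\<^sub>C x"] by (simp add: X_scaleC cinner_scaleC_left)
    with Re_eq show ?thesis
      by (auto intro: complex_eqI)
  qed
  then obtain G where G: "\<And>x y. cinner (X x) y = cinner x (G y)"
    by metis
  have "bounded_linear G"
  proof (rule bounded_linear_intro)
    show "G (x + y) = G x + G y" for x y
      by (rule cinner_left_eqI) (simp add: G[symmetric] cinner_add_right)
    show "G (r *\<^sub>R x) = r *\<^sub>R G x" for r x
      by (rule cinner_left_eqI) (simp add: G[symmetric] cinner_scaleR_right)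
    show "norm (G y) \<le> norm y * norm X" for y
    proof (cases "G y = 0")
      case False
      \<comment> \<open>Testing the adjoint relation at \<open>G y\<close> itself gives a bound on
        the square of its norm, from which one factor is cancelled.\<close>
      have "cinner (X (G y)) y = of_real ((norm (G y))\<^sup>2)"
        by (simp only: G cinner_self)
      then have "(norm (G y))\<^sup>2 \<le> norm (X (G y)) * norm y"
        using Re_cinner_le[of "X (G y)" y] by simp
      also have "\<dots> \<le> norm X * norm (G y) * norm y"
        by (simp add: mult_right_mono norm_blinfun)
      finally have "norm (G y) * norm (G y) \<le> norm (G y) * (norm y * norm X)"
        by (simp add: power2_eq_square ac_simps)
      then show ?thesis
        using False by simp
    qed simp
  qed
  then have adjoint: "\<forall>x y. cinner (X x) y = cinner x (Blinfun G y)"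
    by (simp add: bounded_linear_Blinfun_apply G)
  have "Y = Blinfun G" if "\<forall>x y. cinner (X x) y = cinner x (blinfun_apply Y y)" for Y
  proof (rule blinfun_eqI)
    show "Y y = Blinfun G y" for y
      by (rule cinner_left_eqI) (metis that adjoint)
  qed
  with adjoint have "\<forall>x y. cinner (X x) y = cinner x (adjoint_op X y)"
    unfolding adjoint_op_def by (rule theI)
  then show ?thesis
    by blast
qed

lemma cinner_adjoint_op_left:
  fixes X :: "'a::chilbert_space \<Rightarrow>\<^sub>L 'a"
  assumes "X \<in> bounded_ops"
  shows "cinner (adjoint_op X y) x = cnj (cinner (X x) y)"
  by (subst cinner_commute) (simp add: cinner_adjoint_op assms)

section \<open>The numerical radius\<close>

lemma numerical_radius_bdd_above:
  "bdd_above (insert 0 {cmod (cinner (blinfun_apply X x) x) | x. norm x = 1})"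
proof (rule bdd_aboveI)
  fix r
  assume "r \<in> insert 0 {cmod (cinner (blinfun_apply X x) x) | x. norm x = 1}"
  moreover have "cmod (cinner (X x) x) \<le> norm X" if "norm x = 1" for x
    using cmod_cinner_le[of "X x" x] norm_blinfun[of X x] that by simp
  ultimately show "r \<le> norm X"
    by auto
qed

lemma numerical_radius_nonneg: "0 \<le> numerical_radius X"
  unfolding numerical_radius_def by (rule cSup_upper[OF _ numerical_radius_bdd_above]) simp

text \<open>The bound must be nonnegative because 0 is adjoined to the set; on the zero space 0 is
  its only element.\<close>

lemma numerical_radius_least:
  fixes X :: "'a::complex_inner \<Rightarrow>\<^sub>L 'a"
  assumes "0 \<le> K" and "\<And>x. norm x = 1 \<Longrightarrow> cmod (cinner (X x) x) \<le> K"
  shows "numerical_radius X \<le> K"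
  unfolding numerical_radius_def using assms by (intro cSup_least) auto

text \<open>Both sides scale quadratically in x, which reduces the claim to a unit vector. This form
  allows test vectors that are not normalised.\<close>

lemma cmod_cinner_le_numerical_radius:
  fixes X :: "'a::complex_inner \<Rightarrow>\<^sub>L 'a"
  shows "cmod (cinner (X x) x) \<le> numerical_radius X * (norm x)\<^sup>2"
proof (cases "x = 0")
  case False
  define u where "u = sgn x"
  have x: "x = norm x *\<^sub>R u" and "norm u = 1"
    using False by (simp_all add: u_def sgn_div_norm)
  then have "cmod (cinner (X u) u) \<le> numerical_radius X"
    unfolding numerical_radius_def by (intro cSup_upper numerical_radius_bdd_above) auto
  moreover have "cmod (cinner (X x) x) = (norm x)\<^sup>2 * cmod (cinner (X u) u)"
    by (subst x, subst (2) x)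
      (simp add: blinfun.scaleR_right cinner_scaleR_left cinner_scaleR_right norm_mult
        power2_eq_square)
  ultimately show ?thesis
    by (simp add: mult.commute[of "numerical_radius X"] mult_left_mono)
qed simp

lemma numerical_radius_add_le:
  "numerical_radius (X + Y) \<le> numerical_radius X + numerical_radius Y"
proof (rule numerical_radius_least)
  show "cmod (cinner ((X + Y) x) x) \<le> numerical_radius X + numerical_radius Y"
    if "norm x = 1" for x
    using cmod_cinner_le_numerical_radius[of X x] cmod_cinner_le_numerical_radius[of Y x] that
      norm_triangle_ineq[of "cinner (X x) x" "cinner (Y x) x"]
    by (simp add: blinfun.add_left cinner_add_left)
qed (simp add: numerical_radius_nonneg)

lemma numerical_radius_scaleR_le: "numerical_radius (r *\<^sub>R X) \<le> \<bar>r\<bar> * numerical_radius X"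
proof (rule numerical_radius_least)
  show "cmod (cinner ((r *\<^sub>R X) x) x) \<le> \<bar>r\<bar> * numerical_radius X" if "norm x = 1" for x
    using cmod_cinner_le_numerical_radius[of X x] that
    by (simp add: blinfun.scaleR_left cinner_scaleR_left norm_mult mult_left_mono)
qed (simp add: numerical_radius_nonneg)

text \<open>Provides integrability of the integrand. Passing from t to s adds (s - t)(Y - X), so the
  seminorm properties give the Lipschitz constant \<omega>(Y - X).\<close>

lemma continuous_on_numerical_radius_affine:
  "continuous_on A (\<lambda>t. numerical_radius ((1 - t) *\<^sub>R X + t *\<^sub>R Y))"
proof -
  let ?L = "numerical_radius (Y - X)"
  let ?f = "\<lambda>t. numerical_radius ((1 - t) *\<^sub>R X + t *\<^sub>R Y)"
  have le: "?f s \<le> ?f t + ?L * \<bar>s - t\<bar>" for s t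
  proof -
    have "(1 - s) *\<^sub>R X + s *\<^sub>R Y = ((1 - t) *\<^sub>R X + t *\<^sub>R Y) + (s - t) *\<^sub>R (Y - X)"
      by (simp add: algebra_simps)
    then show ?thesis
      using numerical_radius_add_le[of "(1 - t) *\<^sub>R X + t *\<^sub>R Y" "(s - t) *\<^sub>R (Y - X)"]
        numerical_radius_scaleR_le[of "s - t" "Y - X"]
      by (simp add: mult.commute)
  qed
  have "?L-lipschitz_on A ?f"
  proof (rule lipschitz_onI)
    show "dist (?f s) (?f t) \<le> ?L * dist s t" for s t
      using le[of s t] le[of t s] by (simp add: dist_real_def abs_minus_commute abs_le_iff)
  qed (rule numerical_radius_nonneg)
  then show ?thesis
    by (rule lipschitz_on_continuous_on)
qed

section \<open>Off-diagonal block operators\<close>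

lemma cinner_off_diagonal:
  fixes B C :: "'a::complex_inner \<Rightarrow>\<^sub>L 'a"
  shows "cinner (block_op 0 B C 0 (u, v)) (u, v) = cinner (B v) u + cinner (C u) v"
  by (simp add: block_op.rep_eq cinner_prod_def)

lemma off_diagonal_affine:
  "block_op 0 (r *\<^sub>R B + s *\<^sub>R B') (r *\<^sub>R C + s *\<^sub>R C') 0
    = r *\<^sub>R block_op 0 B C 0 + s *\<^sub>R block_op 0 B' C' 0"
  by (rule blinfun_eqI)
    (simp add: block_op.rep_eq blinfun.add_left blinfun.scaleR_left)

text \<open>The two block operators are adjoint to each other on the direct sum, so their quadratic
  forms are complex conjugates.\<close>

lemma numerical_radius_off_diagonal_swap_le:
  fixes S T :: "'a::chilbert_space \<Rightarrow>\<^sub>L 'a"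
  assumes "S \<in> bounded_ops" and "T \<in> bounded_ops"
  shows "numerical_radius (block_op 0 T (adjoint_op S) 0)
    \<le> numerical_radius (block_op 0 S (adjoint_op T) 0)"
proof (rule numerical_radius_least)
  fix p :: "'a \<times> 'a"
  assume "norm p = 1"
  obtain u v where p: "p = (u, v)"
    by (cases p)
  have "cinner (block_op 0 T (adjoint_op S) 0 p) p
      = cnj (cinner (block_op 0 S (adjoint_op T) 0 p) p)"
    by (simp add: p cinner_off_diagonal cinner_adjoint_op_left assms)
  then show "cmod (cinner (block_op 0 T (adjoint_op S) 0 p) p)
      \<le> numerical_radius (block_op 0 S (adjoint_op T) 0)"
    using cmod_cinner_le_numerical_radius[of "block_op 0 S (adjoint_op T) 0" p] \<open>norm p = 1\<close>
    by simp
qed (rule numerical_radius_nonneg)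

lemma norm_le_numerical_radius_off_diagonal:
  fixes B C X :: "'a::complex_inner \<Rightarrow>\<^sub>L 'a"
  assumes "\<And>u v. Re (cinner (B v) u + cinner (C u) v) = Re (cinner (X v) u)"
  shows "norm X \<le> 2 * numerical_radius (block_op 0 B C 0)" (is "_ \<le> 2 * ?w")
proof (rule norm_blinfun_bound)
  show "norm (X v) \<le> 2 * ?w * norm v" for v
  proof (cases "X v = 0")
    case False
    then have "v \<noteq> 0"
      by auto
    \<comment> \<open>Then <X v, u> = norm v * norm (X v), while u and v have equal norms, so (u, v)
      has squared norm 2 (norm v)^2. This is the source of the factor 2.\<close>
    define u where "u = (norm v / norm (X v)) *\<^sub>R X v"
    have "norm u = norm v"
      using False by (simp add: u_def)
    have "norm v * norm (X v) = Re (cinner (X v) u)"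
      using False by (simp add: u_def cinner_scaleR_right cinner_self power2_eq_square)
    also have "\<dots> = Re (cinner (block_op 0 B C 0 (u, v)) (u, v))"
      by (simp add: cinner_off_diagonal assms[symmetric])
    also have "\<dots> \<le> ?w * (norm (u, v))\<^sup>2"
      by (rule order_trans[OF complex_Re_le_cmod cmod_cinner_le_numerical_radius])
    also have "(norm (u, v))\<^sup>2 = 2 * (norm v)\<^sup>2"
      using \<open>norm u = norm v\<close> by (simp add: norm_prod_def)
    finally have "norm v * norm (X v) \<le> norm v * (2 * ?w * norm v)"
      by (simp add: power2_eq_square ac_simps)
    then show ?thesis
      using \<open>v \<noteq> 0\<close> by simp
  qed (simp add: numerical_radius_nonneg)
qed (simp add: numerical_radius_nonneg)

theorem theorem2p2:
  fixes S T :: "'h::chilbert_space \<Rightarrow>\<^sub>L 'h"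
  assumes "S \<in> bounded_ops" and "T \<in> bounded_ops"
  shows "(\<lambda>t. numerical_radius (block_op 0 ((1 - t) *\<^sub>R S + t *\<^sub>R T)
            (t *\<^sub>R adjoint_op S + (1 - t) *\<^sub>R adjoint_op T) 0)) integrable_on {0..1}
    \<and> norm (S + T) \<le> 2 * integral {0..1} (\<lambda>t. numerical_radius
            (block_op 0 ((1 - t) *\<^sub>R S + t *\<^sub>R T)
              (t *\<^sub>R adjoint_op S + (1 - t) *\<^sub>R adjoint_op T) 0))
    \<and> 2 * integral {0..1} (\<lambda>t. numerical_radius
            (block_op 0 ((1 - t) *\<^sub>R S + t *\<^sub>R T)
              (t *\<^sub>R adjoint_op S + (1 - t) *\<^sub>R adjoint_op T) 0))
          \<le> 2 * numerical_radius (block_op 0 S (adjoint_op T) 0)"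
proof -
  let ?M = "block_op 0 S (adjoint_op T) 0" and ?N = "block_op 0 T (adjoint_op S) 0"
  define f where "f t = numerical_radius (block_op 0 ((1 - t) *\<^sub>R S + t *\<^sub>R T)
    (t *\<^sub>R adjoint_op S + (1 - t) *\<^sub>R adjoint_op T) 0)" for t
  have f_eq: "f t = numerical_radius ((1 - t) *\<^sub>R ?M + t *\<^sub>R ?N)" for t
    unfolding f_def off_diagonal_affine[symmetric] by (simp add: add.commute)
  have lower: "norm (S + T) / 2 \<le> f t" for t
  proof -
    \<comment> \<open>Up to conjugation the lower left entry contributes t <S v, u> + (1 - t) <T v,
      u>. Added to the upper right entry, its real part raises both coefficients to 1, so t drops
      out.\<close>
    have "norm (S + T) \<le> 2 * f t"
      unfolding f_def
      by (rule norm_le_numerical_radius_off_diagonal)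
        (simp add: blinfun.add_left blinfun.scaleR_left cinner_add_left cinner_scaleR_left
          cinner_adjoint_op_left assms, simp add: algebra_simps)
    then show ?thesis
      by simp
  qed
  have upper: "f t \<le> numerical_radius ?M" if "t \<in> {0..1}" for t
  proof -
    \<comment> \<open>Convexity bounds the value by the endpoints \<open>?M\<close> and
      \<open>?N\<close>, and the radius of \<open>?N\<close> is at most that of
      \<open>?M\<close>.\<close>
    have "f t \<le> (1 - t) * numerical_radius ?M + t * numerical_radius ?N"
      using numerical_radius_add_le[of "(1 - t) *\<^sub>R ?M" "t *\<^sub>R ?N"]
        numerical_radius_scaleR_le[of "1 - t" ?M] numerical_radius_scaleR_le[of t ?N] that
      by (simp add: f_eq)
    also have "\<dots> \<le> (1 - t) * numerical_radius ?M + t * numerical_radius ?M"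
      using numerical_radius_off_diagonal_swap_le[OF assms] that by (simp add: mult_left_mono)
    finally show ?thesis
      by (simp add: algebra_simps)
  qed
  \<comment> \<open>Integrability is part of the claim, since \<open>integral\<close> takes the
    default value 0 on functions that are not integrable.\<close>
  have int: "f integrable_on {0..1}"
    unfolding f_eq by (intro integrable_continuous_real continuous_on_numerical_radius_affine)
  \<comment> \<open>The interval has length 1, so pointwise constant bounds pass unchanged to the
    integral.\<close>
  have "norm (S + T) / 2 \<le> integral {0..1} f"
    using integral_le[OF integrable_const_ivl int, of "norm (S + T) / 2"] lower by simp
  moreover have "integral {0..1} f \<le> numerical_radius ?M"
    using integral_le[OF int integrable_const_ivl, of "numerical_radius ?M"] upper by simp
  ultimately show ?thesis
    using int unfolding f_def by simp
qed

end
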